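(* Fix a real number $0<\gamma\le 1$ and integers $q\ge 2$, $1\le s\le t$, and $m\ge 1$. As $n\to\infty$, \[ \max_{\substack{x,y\in\Sigma_q^n\\ r(x),\,r(y)\le \gamma n\\ |D_s(x)\cap D_s(y)|\le m}} |D_t(x)\cap D_t(y)| \le \frac{m\gamma^{t-s}}{(t-s)!}\,n^{t-s}+O_{s,t,m}\!\left(n^{t-s-1}\right). \]
   Context: $\Sigma_q$ is an alphabet of size $q\ge2$, and $\Sigma_q^n$ is the set of sequences of length $n$ over $\Sigma_q$. For sequences $w,x$, write $w\preccurlyeq x$ if $w$ is a (not necessarily contiguous) subsequence of $x$. For $x\in\Sigma_q^n$ and $0\le t\le n$, the $t$-deletion ball is $D_t(x)=\{w\in\Sigma_q^{n-t}: w\preccurlyeq x\}$. $r(x)$ is the number of runs of $x$, i.e. of maximal blocks of consecutive identical symbols. $O_{s,t,m}(f(n))$ denotes a quantity bounded in absolute value by $C f(n)$ for all sufficiently large $n$, where $C$ depends only on $s,t,m$ (how large $n$ must be may depend on all the fixed parameters). *)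

theory Defs
  imports Complex_Main "HOL-Library.Sublist"
begin

definition words :: "nat \<Rightarrow> nat \<Rightarrow> nat list set" where
  "words q n = {w. set w \<subseteq> {..<q} \<and> length w = n}"

(* The natural-number subtraction is only meaningful for t \<le> length x. *)
definition deletion_ball :: "nat \<Rightarrow> nat \<Rightarrow> nat list \<Rightarrow> nat list set" where
  "deletion_ball q t x = {w \<in> words q (length x - t). subseq w x}"

(* Blocks are nonempty sets of consecutive positions, so that blocks of equal content at
   different places stay distinct. *)
definition const_blocks :: "'a list \<Rightarrow> nat set set" where
  "const_blocks x =
     {{i..<j} | i j. i < j \<and> j \<le> length x \<and> (\<forall>k\<in>{i..<j}. x ! k = x ! i)}"

definition runs :: "'a list \<Rightarrow> nat set set" where
  "runs x = {B \<in> const_blocks x. \<forall>B'\<in>const_blocks x. B \<subseteq> B' \<longrightarrow> B' = B}"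

definition num_runs :: "'a list \<Rightarrow> nat" where
  "num_runs x = card (runs x)"

definition admissible_pairs ::
    "nat \<Rightarrow> real \<Rightarrow> nat \<Rightarrow> nat \<Rightarrow> nat \<Rightarrow> (nat list \<times> nat list) set" where
  "admissible_pairs q \<gamma> s m n =
     {(x, y). x \<in> words q n \<and> y \<in> words q n \<and>
        real (num_runs x) \<le> \<gamma> * real n \<and> real (num_runs y) \<le> \<gamma> * real n \<and>
        card (deletion_ball q s x \<inter> deletion_ball q s y) \<le> m}"

(* By finite_admissible_pairs and eventually_admissible_pairs_nonempty below, the maximum
   is over a finite set, nonempty for all large n. *)
definition max_ball_intersection ::
    "nat \<Rightarrow> real \<Rightarrow> nat \<Rightarrow> nat \<Rightarrow> nat \<Rightarrow> nat \<Rightarrow> nat" where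
  "max_ball_intersection q \<gamma> s t m n =
     Max ((\<lambda>(x, y). card (deletion_ball q t x \<inter> deletion_ball q t y)) `
            admissible_pairs q \<gamma> s m n)"

lemma num_runs_eq_length_remdups_adj: "num_runs x = length (remdups_adj x)"
proof -
  define n where "n = length x"
  define ys where "ys = remdups_adj x"
  obtain f :: "nat \<Rightarrow> nat" where f: "mono f" "f ` {0..<n} = {0..<length ys}"
    "\<forall>i<n. x ! i = ys ! f i" "\<forall>i. i + 1 < n \<longrightarrow> (x ! i = x ! (i + 1) \<longleftrightarrow> f i = f (i + 1))"
    using remdups_adj_altdef[of x ys] unfolding n_def ys_def by auto
  define L where "L k = {i. i < n \<and> f i = k}" for k
  have L_ne: "L k \<noteq> {}" if "k < length ys" for k
  proof -
    have "k \<in> f ` {0..<n}" using that f(2) by simp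
    then show ?thesis unfolding L_def by auto
  qed
  have L_block: "L k \<in> const_blocks x" if "k < length ys" for k
  proof -
    have fin: "finite (L k)" unfolding L_def by simp
    define a where "a = Min (L k)"
    define b where "b = Max (L k)"
    have aL: "a \<in> L k" and bL: "b \<in> L k"
      using fin L_ne[OF that] by (auto simp: a_def b_def)
    have "L k = {a..<Suc b}"
    proof (intro equalityI subsetI)
      fix i assume "i \<in> L k"
      then show "i \<in> {a..<Suc b}"
        using fin by (auto simp: a_def b_def less_Suc_eq_le)
    next
      fix i assume i: "i \<in> {a..<Suc b}"
      then have "f a \<le> f i" "f i \<le> f b" using f(1) by (auto simp: mono_def)
      then show "i \<in> L k" using aL bL i by (auto simp: L_def)
    qed
    moreover have "a < Suc b" using aL calculation by simp
    moreover have "Suc b \<le> length x" using bL by (simp add: L_def n_def)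
    moreover have "\<forall>i\<in>{a..<Suc b}. x ! i = x ! a"
    proof
      fix i assume "i \<in> {a..<Suc b}"
      then have "i \<in> L k" using calculation(1) by simp
      then show "x ! i = x ! a" using f(3) aL by (simp add: L_def)
    qed
    ultimately show ?thesis unfolding const_blocks_def
      by blast
  qed
  have block_sub: "\<exists>k<length ys. B \<subseteq> L k" if B: "B \<in> const_blocks x" for B
  proof -
    obtain i j where ij: "B = {i..<j}" "i < j" "j \<le> n" "\<forall>k\<in>{i..<j}. x ! k = x ! i"
      using B unfolding const_blocks_def n_def by blast
    have c: "i + d < j \<Longrightarrow> f (i + d) = f i" for d
    proof (induction d)
      case (Suc d)
      have "x ! (i + d) = x ! i" "x ! (i + d + 1) = x ! i"
        by (rule bspec[OF ij(4)], use Suc.prems in simp)+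
      then have "f (i + d) = f (i + d + 1)" using f(4)[rule_format, of "i + d"] Suc.prems ij(3) by simp
      then show ?case using Suc by simp
    qed simp
    have "B \<subseteq> L (f i)"
    proof
      fix l assume "l \<in> B"
      then show "l \<in> L (f i)" using c[of "l - i"] ij(1-3) by (auto simp: L_def)
    qed
    moreover have "f i < length ys" using f(2) ij(2,3) by force
    ultimately show ?thesis by blast
  qed
  have L_inj: "k = k'" if "k < length ys" "L k \<subseteq> L k'" for k k'
    using L_ne[OF that(1)] that(2) by (auto simp: L_def)
  have "runs x = L ` {..<length ys}"
  proof (intro equalityI subsetI)
    fix B assume "B \<in> runs x"
    then have B: "B \<in> const_blocks x" "\<And>B'. B' \<in> const_blocks x \<Longrightarrow> B \<subseteq> B' \<Longrightarrow> B' = B"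
      by (auto simp: runs_def)
    obtain k where "k < length ys" "B \<subseteq> L k" using block_sub[OF B(1)] by blast
    then show "B \<in> L ` {..<length ys}" using B(2)[OF L_block] by blast
  next
    fix B assume "B \<in> L ` {..<length ys}"
    then obtain k where k: "k < length ys" "B = L k" by auto
    have "B' = L k" if B': "B' \<in> const_blocks x" "L k \<subseteq> B'" for B'
    proof -
      obtain k' where "k' < length ys" "B' \<subseteq> L k'" using block_sub[OF B'(1)] by blast
      then show ?thesis using L_inj[OF k(1), of k'] B'(2) by blast
    qed
    then show "B \<in> runs x" using L_block[OF k(1)] k(2) by (auto simp: runs_def)
  qed
  moreover have "inj_on L {..<length ys}"
    by (rule inj_onI) (use L_inj in auto)
  ultimately show ?thesis by (simp add: num_runs_def card_image ys_def)
qed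

lemma finite_admissible_pairs: "finite (admissible_pairs q \<gamma> s m n)"
proof (rule finite_subset)
  show "admissible_pairs q \<gamma> s m n \<subseteq> words q n \<times> words q n"
    unfolding admissible_pairs_def by blast
  have "finite (words q n)"
    unfolding words_def by (rule finite_lists_length_eq) simp
  then show "finite (words q n \<times> words q n)" by simp
qed

lemma eventually_admissible_pairs_nonempty:
  assumes "0 < \<gamma>" and "2 \<le> q"
  shows "\<forall>\<^sub>F n in sequentially. admissible_pairs q \<gamma> s m n \<noteq> {}"
proof -
  obtain N :: nat where N: "1 / \<gamma> \<le> real N" using real_arch_simple by blast
  have "admissible_pairs q \<gamma> s m n \<noteq> {}" if n: "n \<ge> N + s + 1" for n
  proof -
    have "1 / \<gamma> \<le> real n" using N n by linarith
    then have g: "1 \<le> \<gamma> * real n" using assms(1) by (simp add: field_simps)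
    have r: "num_runs (replicate n a) = 1" for a :: nat
      using n by (simp add: num_runs_eq_length_remdups_adj remdups_adj_replicate)
    have e: "set w \<subseteq> {a}" if sub: "subseq w (replicate n a)" for w and a :: nat
    proof
      fix b assume "b \<in> set w"
      then obtain c where "c \<in> set (replicate n a)" "b = c"
        using list_emb_set[OF sub] by metis
      then show "b \<in> {a}" by simp
    qed
    have "deletion_ball q s (replicate n 0) \<inter> deletion_ball q s (replicate n 1) = {}"
    proof (rule ccontr)
      assume "\<not> ?thesis"
      then obtain w :: "nat list" where w: "length w = n - s"
        "subseq w (replicate n 0)" "subseq w (replicate n 1)"
        unfolding deletion_ball_def words_def length_replicate by blast
      have "set w = {}" using e[OF w(2)] e[OF w(3)] by (cases w) auto
      then show False using w(1) n by auto
    qed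
    then have "(replicate n 0, replicate n 1) \<in> admissible_pairs q \<gamma> s m n"
      using g r assms(2) by (auto simp: admissible_pairs_def words_def)
    then show ?thesis by blast
  qed
  then show ?thesis unfolding eventually_sequentially by blast
qed

end

theory Submission
  imports Defs
begin

text \<open>
  A common subsequence of \<open>x\<close> and \<open>y\<close> extends to one that is maximal for the subsequence order.
  Comparing first letters shows that at most \<open>2l choose l\<close> maximal common subsequences have
  length \<open>n - l\<close>, whatever the alphabet. A word of \<open>D\<^sub>t(x) \<inter> D\<^sub>t(y)\<close> lies below a maximal one of
  length at least \<open>n - s\<close>, and hence below one of the at most \<open>m\<close> words of \<open>D\<^sub>s(x) \<inter> D\<^sub>s(y)\<close>,
  or below one of boundedly many words of length \<open>n - l\<close> with \<open>l > s\<close>. A word with \<open>r\<close> runs has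
  at most \<open>r + k - 1 choose k\<close> subsequences obtained by \<open>k\<close> deletions, and passing to
  a subsequence does not increase \<open>r\<close>; so the first kind contributes the main term and
  the second kind only \<open>O(n^(t-s-1))\<close>.
\<close>

section \<open>Deletion balls without an alphabet\<close>

text \<open>The length condition is additive, so the set is empty when \<open>k\<close> exceeds
  \<open>length z\<close>; truncated subtraction would leave the empty word there.\<close>

definition subs :: "nat \<Rightarrow> 'a list \<Rightarrow> 'a list set" where
  "subs k z = {w. subseq w z \<and> length w + k = length z}"

lemma finite_subseqs: "finite {w. subseq w z}"
proof -
  have "{w. subseq w z} = set (subseqs z)" by auto
  then show ?thesis by simp
qed

lemma finite_subs: "finite (subs k z)"
  by (rule finite_subset[OF _ finite_subseqs[of z]]) (auto simp: subs_def)

lemma subseq_set: "subseq w z \<Longrightarrow> set w \<subseteq> set z"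
  by (auto dest: list_emb_set)

lemma deletion_ball_eq_subs:
  assumes "x \<in> words q n" "t \<le> n"
  shows "deletion_ball q t x = subs t x"
  using assms by (fastforce simp: deletion_ball_def subs_def words_def dest: subseq_set)

section \<open>Counting subsequences by runs\<close>

lemma subseq_replicate_append:
  assumes "subseq w (replicate a c @ z)" "w = [] \<or> hd w \<noteq> c"
  shows "subseq w z"
  using assms by (induction a) (cases w; auto)+

text \<open>The index \<open>j\<close> counts the letters deleted from the leading block. A word
  starting with \<open>c\<close> may take the first \<open>c\<close> of the block; any other word
  skips the whole block, which costs all its letters.\<close>

lemma card_subs_replicate_append:
  "card (subs k (replicate a c @ z)) \<le> (\<Sum>j\<le>min a k. card (subs (k - j) z))"
proof (induction a)
  case (Suc a)
  let ?y = "replicate a c @ z"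
  \<comment> \<open>This is \<open>subs (k - Suc a) z\<close> if \<open>Suc a\<close> is at most
    \<open>k\<close>; otherwise its words would be longer than \<open>z\<close> and it is
    empty.\<close>
  let ?N = "{w. subseq w z \<and> length w + k = length z + Suc a}"
  have fin: "finite ?N" by (rule finite_subset[OF _ finite_subseqs[of z]]) auto
  have "subs k (c # ?y) \<subseteq> (#) c ` subs k ?y \<union> ?N"
  proof
    fix w assume w: "w \<in> subs k (c # ?y)"
    show "w \<in> (#) c ` subs k ?y \<union> ?N"
    proof (cases "w = [] \<or> hd w \<noteq> c")
      case True
      then show ?thesis using w subseq_replicate_append[of w "Suc a" c z] by (auto simp: subs_def)
    next
      case False
      then obtain v where "w = c # v" by (cases w) auto
      then show ?thesis using w by (auto simp: subs_def)
    qed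
  qed
  then have "card (subs k (c # ?y)) \<le> card ((#) c ` subs k ?y \<union> ?N)"
    by (intro card_mono) (use fin in \<open>auto simp: finite_subs\<close>)
  also have "\<dots> \<le> card (subs k ?y) + card ?N"
    using card_Un_le[of "(#) c ` subs k ?y" ?N] card_image_le[OF finite_subs, of "(#) c" k ?y]
    by linarith
  also have "\<dots> \<le> (\<Sum>j\<le>min (Suc a) k. card (subs (k - j) z))"
  proof (cases "Suc a \<le> k")
    case True
    then have "?N = subs (k - Suc a) z" by (auto simp: subs_def)
    then show ?thesis using Suc True by (simp add: min_def)
  next
    case False
    have "?N = {}" using False by (auto dest!: list_emb_length)
    then show ?thesis using Suc False by (cases "a = k") (simp_all add: min_def del: Collect_empty_eq)
  qed
  finally show ?case by simp
qed (auto simp: subs_def)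

lemma length_remdups_adj_Cons:
  "length (remdups_adj (a # x)) = length (remdups_adj x) + (if x \<noteq> [] \<and> hd x = a then 0 else 1)"
  by (cases x) auto

lemma remdups_adj_replicate_append:
  "z = [] \<or> hd z \<noteq> c \<Longrightarrow>
     length (remdups_adj (replicate (Suc a) c @ z)) = Suc (length (remdups_adj z))"
  by (induction a) (auto simp: length_remdups_adj_Cons)

text \<open>Stripping the leading run leaves a word with one run fewer, and \<open>j\<close>
  deletions inside that run leave \<open>k - j\<close> for the rest; the binomials then add up by
  the hockey-stick identity.\<close>

lemma card_subs_le: "card (subs k z) \<le> (length (remdups_adj z) + k - 1) choose k"
proof (induction "length z" arbitrary: z k rule: less_induct)
  case less
  show ?case
  proof (cases z)
    case Nil
    then have "subs k z \<subseteq> (if k = 0 then {[]} else {})" by (auto simp: subs_def)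
    from card_mono[OF _ this] Nil show ?thesis by (cases k) auto
  next
    case (Cons c v)
    define y where "y = dropWhile (\<lambda>b. b = c) v"
    define a where "a = length (takeWhile (\<lambda>b. b = c) v)"
    have "takeWhile (\<lambda>b. b = c) v = replicate a c"
      unfolding a_def by (induction v) auto
    then have "v = replicate a c @ y" using takeWhile_dropWhile_id y_def by metis
    then have z: "z = replicate (Suc a) c @ y" using Cons by simp
    have y: "y = [] \<or> hd y \<noteq> c" unfolding y_def using hd_dropWhile[of "\<lambda>b. b = c" v] by auto
    define r where "r = length (remdups_adj y)"
    have r: "length (remdups_adj z) = Suc r"
      using remdups_adj_replicate_append[OF y] z r_def by simp
    have "card (subs k z) \<le> (\<Sum>j\<le>min (Suc a) k. card (subs (k - j) y))"
      unfolding z by (rule card_subs_replicate_append)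
    \<comment> \<open>Forgetting the length of the run makes the bound depend on the number of runs
      alone.\<close>
    also have "\<dots> \<le> (\<Sum>j\<le>k. card (subs (k - j) y))" by (intro sum_mono2) auto
    also have "\<dots> \<le> (\<Sum>j\<le>k. (r + (k - j) - 1) choose (k - j))"
      unfolding r_def by (intro sum_mono less) (simp add: z)
    also have "\<dots> = (\<Sum>j\<le>k. (r + j - 1) choose j)"
      using sum.nat_diff_reindex[of "\<lambda>j. (r + j - 1) choose j" "Suc k"]
      by (simp add: lessThan_Suc_atMost)
    also have "\<dots> = (r + k) choose k"
    \<comment> \<open>For \<open>r = 0\<close> the subtraction truncates and only the term
      \<open>j = 0\<close> is nonzero; for \<open>r > 0\<close> the hockey-stick identity
      applies.\<close>
    proof (cases r)
      case 0
      have "(\<Sum>j\<le>k. (r + j - 1) choose j) = (\<Sum>j\<in>{0}. (r + j - 1) choose j)"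
        by (rule sum.mono_neutral_right) (auto simp: 0)
      then show ?thesis using 0 by simp
    next
      case (Suc p)
      then show ?thesis using sum_choose_lower[of p k] by simp
    qed
    finally show ?thesis using r by simp
  qed
qed

lemma length_remdups_adj_subseq_le:
  "subseq w x \<Longrightarrow> length (remdups_adj w) \<le> length (remdups_adj x)"
proof (induction x arbitrary: w)
  case (Cons a x)
  show ?case
  proof (cases "subseq w x")
    case True
    then show ?thesis using Cons.IH[of w] by (simp add: length_remdups_adj_Cons)
  next
    case False
    then obtain v where v: "w = a # v" "subseq v x"
      using Cons.prems by (cases w) (auto split: if_splits)
    \<comment> \<open>If \<open>x\<close> starts with \<open>a\<close> but \<open>v\<close> does
      not, then \<open>v\<close> embeds into the tail of \<open>x\<close>, so \<open>a # v\<close>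
      would already embed into \<open>x\<close>. Hence either \<open>a\<close> adds no run to
      \<open>v\<close>, or it also adds one to \<open>x\<close>.\<close>
    then have "v \<noteq> [] \<and> hd v = a \<or> \<not> (x \<noteq> [] \<and> hd x = a)"
      using False by (cases x; cases v) (auto split: if_splits)
    then show ?thesis using v Cons.IH[of v] by (auto simp: length_remdups_adj_Cons)
  qed
qed simp

section \<open>Intermediate and maximal common subsequences\<close>

text \<open>Letters of \<open>z\<close> outside an embedding of \<open>w\<close> can be restored one
  at a time. This cuts a long common subsequence down to length \<open>n - s\<close> without losing
  \<open>w\<close>.\<close>

lemma subseq_intermediate_length:
  assumes "subseq w z" "length w \<le> j" "j \<le> length z"
  obtains u where "subseq w u" "subseq u z" "length u = j"
proof -
  have "\<exists>u. subseq w u \<and> subseq u z \<and> length u = j"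
    using assms
  proof (induction arbitrary: j rule: list_emb.induct)
    case (list_emb_Nil z)
    show ?case
      by (rule exI[of _ "take j z"]) (use list_emb_Nil in \<open>auto intro: take_is_prefix\<close>)
  next
    case (list_emb_Cons w z a)
    show ?case
    proof (cases "j \<le> length z")
      case True
      then show ?thesis using list_emb_Cons.IH[of j] list_emb_Cons.prems by auto
    next
      case False
      then have "length (a # z) = j" using list_emb_Cons.prems by simp
      then show ?thesis using list_emb_Cons.hyps by (intro exI[of _ "a # z"]) auto
    qed
  next
    case (list_emb_Cons2 a b w z)
    then obtain i where i: "j = Suc i" by (cases j) auto
    then obtain u where "subseq w u" "subseq u z" "length u = i"
      using list_emb_Cons2.IH[of i] list_emb_Cons2.prems by auto
    then show ?case using i list_emb_Cons2.hyps by (intro exI[of _ "a # u"]) auto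
  qed
  then show ?thesis using that by blast
qed

text \<open>Maximality refers to the subsequence order, not to length, so members may have different
  lengths.\<close>

definition max_common_subseqs :: "'a list \<Rightarrow> 'a list \<Rightarrow> 'a list set" where
  "max_common_subseqs x y =
     {w. subseq w x \<and> subseq w y \<and> (\<forall>v. subseq v x \<longrightarrow> subseq v y \<longrightarrow> subseq w v \<longrightarrow> v = w)}"

text \<open>A longest common subsequence above \<open>w\<close> is maximal, since a proper extension
  of it would be longer.\<close>

lemma extend_to_max_common_subseq:
  assumes "subseq w x" "subseq w y"
  obtains z where "z \<in> max_common_subseqs x y" "subseq w z"
proof -
  let ?P = "\<lambda>v. subseq v x \<and> subseq v y \<and> subseq w v"
  have "\<exists>z. ?P z \<and> (\<forall>v. ?P v \<longrightarrow> length v \<le> length z)"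
    by (rule ex_has_greatest_nat[where k = w and b = "Suc (length x)"])
       (use assms in \<open>auto dest!: list_emb_length\<close>)
  then obtain z where z: "?P z" "\<And>v. ?P v \<Longrightarrow> length v \<le> length z" by blast
  have "v = z" if "subseq v x" "subseq v y" "subseq z v" for v
  proof -
    have "subseq w v" using z(1) that(3) subseq_order.trans by blast
    then have "length v \<le> length z" using z(2) that by blast
    then show ?thesis using that(3) list_emb_length subseq_same_length le_antisym by metis
  qed
  then show ?thesis using that z(1) by (auto simp: max_common_subseqs_def)
qed

text \<open>A word that does not start with the shared letter embeds into both tails, so prepending
  that letter would properly extend it.\<close>

lemma max_common_subseqs_Cons_same:
  "max_common_subseqs (a # x) (a # y) \<subseteq> (#) a ` max_common_subseqs x y"
proof
  fix w assume "w \<in> max_common_subseqs (a # x) (a # y)"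
  then have w: "subseq w (a # x)" "subseq w (a # y)"
    and wmax: "\<And>v. subseq v (a # x) \<Longrightarrow> subseq v (a # y) \<Longrightarrow> subseq w v \<Longrightarrow> v = w"
    by (auto simp: max_common_subseqs_def)
  have "\<exists>v. w = a # v"
  proof (rule ccontr)
    assume "\<not> ?thesis"
    then have "subseq w x" "subseq w y" using w by (cases w; auto)+
    then have "a # w = w" using wmax[of "a # w"] by auto
    then show False by simp
  qed
  then obtain v where v: "w = a # v" by blast
  have "v \<in> max_common_subseqs x y"
    using w wmax[of "a # _"] v by (auto simp: max_common_subseqs_def)
  then show "w \<in> (#) a ` max_common_subseqs x y" using v by blast
qed

text \<open>The first letter of \<open>w\<close> differs from \<open>a\<close> or from
  \<open>b\<close>, so \<open>w\<close> survives dropping that letter; it stays maximal because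
  fewer competitors remain.\<close>

lemma max_common_subseqs_Cons_diff:
  assumes "a \<noteq> b"
  shows "max_common_subseqs (a # x) (b # y) \<subseteq>
           max_common_subseqs x (b # y) \<union> max_common_subseqs (a # x) y"
proof
  fix w assume w: "w \<in> max_common_subseqs (a # x) (b # y)"
  then have "subseq w x \<or> subseq w y"
    using assms by (cases w) (auto simp: max_common_subseqs_def split: if_splits)
  then show "w \<in> max_common_subseqs x (b # y) \<union> max_common_subseqs (a # x) y"
    using w by (auto simp: max_common_subseqs_def)
qed

lemma finite_max_common_subseqs: "finite (max_common_subseqs x y)"
  by (rule finite_subset[OF _ finite_subseqs[of x]]) (auto simp: max_common_subseqs_def)

text \<open>The deficits \<open>i\<close> and \<open>j\<close> are kept separate because dropping a
  first letter lowers just one of them. Equal first letters leave both unchanged, unequal ones give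
  Pascal's recurrence, so no alphabet size enters.\<close>

lemma card_max_common_subseqs_le:
  "card {w \<in> max_common_subseqs x y. length w + i = length x \<and> length w + j = length y}
     \<le> (i + j) choose i"
proof -
  define S where "S x y i j =
    {w \<in> max_common_subseqs x y. length w + i = length x \<and> length w + j = length y}"
    for x y :: "'a list" and i j
  have finS: "finite (S x y i j)" for x y i j
    unfolding S_def by (rule finite_subset[OF _ finite_max_common_subseqs[of x y]]) auto
  have trivial: "card (S x y i j) \<le> (i + j) choose i" if "i = 0 \<or> j = 0" for x y i j
  proof -
    have "S x y i j \<subseteq> {if i = 0 then x else y}"
      using that by (auto simp: S_def max_common_subseqs_def intro: subseq_same_length)
    from card_mono[OF _ this] that show ?thesis by auto
  qed
  have "card (S x y i j) \<le> (i + j) choose i"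
  proof (induction x arbitrary: y i j)
    case Nil
    show ?case
    proof (cases "i = 0")
      case False
      then have "S [] y i j = {}" by (auto simp: S_def)
      then show ?thesis by simp
    qed (intro trivial disjI1)
  next
    case (Cons a x)
    \<comment> \<open>The inner induction is on \<open>y\<close>, since one branch of the recursion
      shortens only \<open>y\<close>.\<close>
    note IHx = this
    show ?case
    proof (induction y arbitrary: i j)
      case Nil
      show ?case
      proof (cases "j = 0")
        case False
        then have "S (a # x) [] i j = {}" by (auto simp: S_def)
        then show ?thesis by simp
      qed (intro trivial disjI2)
    next
      case (Cons b y)
      show ?case
      proof (cases "i = 0 \<or> j = 0")
        case True
        then show ?thesis by (rule trivial)
      next
        case False
        then obtain i' j' where ij: "i = Suc i'" "j = Suc j'"
          by (cases i; cases j) auto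
        show ?thesis
        proof (cases "a = b")
          case True
          have "S (a # x) (b # y) i j \<subseteq> (#) a ` S x y i j"
            using max_common_subseqs_Cons_same[of a x y] True by (force simp: S_def)
          then have "card (S (a # x) (b # y) i j) \<le> card (S x y i j)"
            by (rule surj_card_le[OF finS])
          then show ?thesis using IHx[of y i j] by linarith
        next
          case False
          have "S (a # x) (b # y) i j \<subseteq> S x (b # y) i' j \<union> S (a # x) y i j'"
            using max_common_subseqs_Cons_diff[OF False, of x y] ij by (auto simp: S_def)
          then have "card (S (a # x) (b # y) i j) \<le> card (S x (b # y) i' j) + card (S (a # x) y i j')"
            using card_mono[OF finite_UnI[OF finS finS]] card_Un_le le_trans by meson
          also have "\<dots> \<le> ((i' + j) choose i') + ((i + j') choose i)"
            using IHx[of "b # y" i' j] Cons[of i j'] by linarith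
          \<comment> \<open>Pascal's rule: both upper arguments equal
            \<open>i + j - 1\<close>.\<close>
          also have "\<dots> = (i + j) choose i" using ij by simp
          finally show ?thesis .
        qed
      qed
    qed
  qed
  then show ?thesis unfolding S_def .
qed

section \<open>The bound at a fixed length\<close>

lemma card_UN_subs_le:
  assumes "finite I" "card I \<le> p" "\<And>z. z \<in> I \<Longrightarrow> length (remdups_adj z) \<le> r"
  shows "card (\<Union>z\<in>I. subs k z) \<le> p * ((r + k - 1) choose k)"
proof -
  have "card (\<Union>z\<in>I. subs k z) \<le> (\<Sum>z\<in>I. card (subs k z))"
    by (rule card_UN_le[OF assms(1)])
  also have "\<dots> \<le> (\<Sum>z\<in>I. (r + k - 1) choose k)"
    using assms(3) by (intro sum_mono order_trans[OF card_subs_le] binomial_right_mono)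
       (auto simp: diff_le_mono)
  also have "\<dots> \<le> p * ((r + k - 1) choose k)" using assms(2) by simp
  finally show ?thesis .
qed

text \<open>\<open>A\<close> collects the words below the intersection of the
  \<open>s\<close>-balls, whose members have at most as many runs as \<open>x\<close>;
  \<open>B l\<close> collects those below maximal common subsequences of length
  \<open>n - l\<close>.\<close>

lemma card_common_subs_le:
  assumes "length x = n" "length y = n" "s \<le> t" "t \<le> n"
    and "card (subs s x \<inter> subs s y) \<le> m"
  shows "card (subs t x \<inter> subs t y) \<le>
    m * ((length (remdups_adj x) + (t - s) - 1) choose (t - s)) +
    (\<Sum>l\<in>{s<..t}. ((2 * l) choose l) * ((n + (t - l) - 1) choose (t - l)))"
proof -
  define M where "M l =
    {w \<in> max_common_subseqs x y. length w + l = length x \<and> length w + l = length y}" for l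
  define A where "A = (\<Union>z\<in>subs s x \<inter> subs s y. subs (t - s) z)"
  define B where "B l = (\<Union>z\<in>M l. subs (t - l) z)" for l
  have finM: "finite (M l)" for l
    unfolding M_def by (rule finite_subset[OF _ finite_max_common_subseqs[of x y]]) auto
  have "subs t x \<inter> subs t y \<subseteq> A \<union> (\<Union>l\<in>{s<..t}. B l)"
  proof
    fix w assume w: "w \<in> subs t x \<inter> subs t y"
    then obtain z where z: "z \<in> max_common_subseqs x y" "subseq w z"
      using extend_to_max_common_subseq[of w x y] by (auto simp: subs_def)
    have zxy: "subseq z x" "subseq z y" using z(1) by (auto simp: max_common_subseqs_def)
    have lw: "length w + t = n" using w assms by (auto simp: subs_def)
    define l where "l = n - length z"
    have l: "length z + l = n" using list_emb_length[OF zxy(1)] assms(1) l_def by simp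
    have lt: "l \<le> t" using list_emb_length[OF z(2)] lw l by linarith
    show "w \<in> A \<union> (\<Union>l\<in>{s<..t}. B l)"
    proof (cases "l \<le> s")
      case True
      then have "length w \<le> n - s" "n - s \<le> length z" using assms lw l by linarith+
      \<comment> \<open>The cut to length exactly \<open>n - s\<close> puts \<open>u\<close> into
        the intersection of the \<open>s\<close>-balls, which has at most \<open>m\<close>
        elements.\<close>
      then obtain u where u: "subseq w u" "subseq u z" "length u = n - s"
        by (rule subseq_intermediate_length[OF z(2)])
      have "subseq u x" "subseq u y" using u(2) zxy subseq_order.trans by blast+
      then have "u \<in> subs s x \<inter> subs s y" using u(3) assms by (simp add: subs_def)
      moreover have "w \<in> subs (t - s) u" using u lw assms by (auto simp: subs_def)
      ultimately show ?thesis unfolding A_def by blast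
    next
      case False
      have "z \<in> M l" using z l assms by (simp add: M_def)
      moreover have "w \<in> subs (t - l) z" using z lw l lt by (auto simp: subs_def)
      ultimately have "w \<in> B l" unfolding B_def by blast
      then show ?thesis using False lt by auto
    qed
  qed
  moreover have "finite (A \<union> (\<Union>l\<in>{s<..t}. B l))"
    unfolding A_def B_def using finM finite_subs by auto
  ultimately have "card (subs t x \<inter> subs t y) \<le> card (A \<union> (\<Union>l\<in>{s<..t}. B l))"
    by (intro card_mono)
  also have "\<dots> \<le> card A + (\<Sum>l\<in>{s<..t}. card (B l))"
    using card_Un_le[of A "\<Union>l\<in>{s<..t}. B l"] card_UN_le[of "{s<..t}" B] by simp
  also have "\<dots> \<le> m * ((length (remdups_adj x) + (t - s) - 1) choose (t - s)) +
    (\<Sum>l\<in>{s<..t}. ((2 * l) choose l) * ((n + (t - l) - 1) choose (t - l)))"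
  proof (intro add_mono sum_mono)
    show "card A \<le> m * ((length (remdups_adj x) + (t - s) - 1) choose (t - s))"
      unfolding A_def using assms(5)
      by (intro card_UN_subs_le)
         (auto simp: finite_subs, auto simp: subs_def intro: length_remdups_adj_subseq_le)
    fix l
    show "card (B l) \<le> ((2 * l) choose l) * ((n + (t - l) - 1) choose (t - l))"
      unfolding B_def
    proof (intro card_UN_subs_le finM)
      show "card (M l) \<le> (2 * l) choose l"
        unfolding M_def using card_max_common_subseqs_le[of x y l l] by (simp add: mult_2)
      \<comment> \<open>The crude bound by \<open>n\<close> runs suffices, as the binomial has
        degree \<open>t - l\<close> in \<open>n\<close>, below \<open>t - s\<close>.\<close>
      fix z assume "z \<in> M l"
      then have "length z \<le> n" using assms(1) by (auto simp: M_def)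
      then show "length (remdups_adj z) \<le> n" using remdups_adj_length[of z] by linarith
    qed
  qed
  finally show ?thesis .
qed

section \<open>Estimates for binomials and powers\<close>

lemma choose_shift_le_power:
  "real ((r + k - 1) choose k) \<le> (real r + real k) ^ k / fact k"
proof -
  have "fact k * ((r + k - 1) choose k) \<le> (r + k - 1) ^ k"
    using binomial_fact_pow[of "r + k - 1" k] by (simp add: mult.commute)
  also have "\<dots> \<le> (r + k) ^ k" by (intro power_mono) auto
  finally have "real (fact k * ((r + k - 1) choose k)) \<le> real ((r + k) ^ k)" by (rule of_nat_mono)
  then show ?thesis by (simp add: field_simps)
qed

text \<open>In the binomial expansion every term except the leading one has a power of
  \<open>u\<close> at most \<open>N ^ k\<close>, and the coefficients sum to at most
  \<open>(1 + c) ^ Suc k\<close>. The separate bound \<open>N\<close> permits \<open>u < 1\<close>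
  and later keeps the constant free of \<open>\<gamma>\<close>.\<close>

lemma power_add_const_le:
  fixes u c N :: real
  assumes "0 \<le> u" "u \<le> N" "1 \<le> N" "0 \<le> c"
  shows "(u + c) ^ Suc k \<le> u ^ Suc k + (1 + c) ^ Suc k * N ^ k"
proof -
  have "(u + c) ^ Suc k = u ^ Suc k + (\<Sum>i\<le>k. of_nat (Suc k choose i) * u ^ i * c ^ (Suc k - i))"
    by (subst binomial_ring) simp
  also have "(\<Sum>i\<le>k. of_nat (Suc k choose i) * u ^ i * c ^ (Suc k - i)) \<le>
      (\<Sum>i\<le>k. of_nat (Suc k choose i) * N ^ k * c ^ (Suc k - i))"
  proof (intro sum_mono mult_right_mono mult_left_mono)
    fix i assume "i \<in> {..k}"
    then show "u ^ i \<le> N ^ k"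
      using assms power_mono[of u N i] power_increasing[of i k N] by force
  qed (use assms in auto)
  also have "\<dots> = N ^ k * (\<Sum>i\<le>k. of_nat (Suc k choose i) * 1 ^ i * c ^ (Suc k - i))"
    by (simp add: sum_distrib_left mult_ac)
  \<comment> \<open>Adding the missing term \<open>i = Suc k\<close> completes the expansion of
    \<open>(1 + c) ^ Suc k\<close>.\<close>
  also have "\<dots> \<le> N ^ k * (\<Sum>i\<le>Suc k. of_nat (Suc k choose i) * 1 ^ i * c ^ (Suc k - i))"
    using assms by (intro mult_left_mono) auto
  also have "\<dots> = (1 + c) ^ Suc k * N ^ k"
    by (subst binomial_ring[of 1 c]) simp
  finally show ?thesis by simp
qed

section \<open>Asymptotics with a uniform constant\<close>

theorem theorem1p2:
  fixes s t m :: nat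
  assumes "1 \<le> s" and "s \<le> t" and "1 \<le> m"
  shows "\<exists>C::real. \<forall>(\<gamma>::real) (q::nat). 0 < \<gamma> \<longrightarrow> \<gamma> \<le> 1 \<longrightarrow> 2 \<le> q \<longrightarrow>
    (\<forall>\<^sub>F n in sequentially.
       real (max_ball_intersection q \<gamma> s t m n)
         \<le> real m * \<gamma> ^ (t - s) / fact (t - s) * real n ^ (t - s)
            + C * real n powi (int t - int s - 1))"
proof -
  \<comment> \<open>The first summand pays for the lower-order part of the main term, the sum for
    the maximal words with \<open>l > s\<close>; \<open>(1 + t) ^ t\<close> dominates every constant
    that arises, and neither \<open>q\<close> nor \<open>\<gamma>\<close> occurs.\<close>
  define D where "D = real m * (1 + real t) ^ t +
    (\<Sum>l\<in>{s<..t}. real ((2 * l) choose l) * (1 + real t) ^ t)"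
  have D0: "0 \<le> D" unfolding D_def by (intro add_nonneg_nonneg sum_nonneg) auto
  have bound: "real (card (deletion_ball q t x \<inter> deletion_ball q t y))
      \<le> real m * \<gamma> ^ (t - s) / fact (t - s) * real n ^ (t - s) + D * real n powi (int t - int s - 1)"
    if \<gamma>: "0 < \<gamma>" "\<gamma> \<le> 1" and n: "t \<le> n" "1 \<le> n" and xy: "(x, y) \<in> admissible_pairs q \<gamma> s m n"
    for q \<gamma> n x y
  proof -
    define r where "r = length (remdups_adj x)"
    have r: "real r \<le> \<gamma> * real n"
      using xy by (auto simp: admissible_pairs_def r_def num_runs_eq_length_remdups_adj)
    have w: "x \<in> words q n" "y \<in> words q n" using xy by (auto simp: admissible_pairs_def)
    have "card (subs s x \<inter> subs s y) \<le> m"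
      using xy w n assms by (simp add: admissible_pairs_def deletion_ball_eq_subs[of _ q n])
    then have "card (subs t x \<inter> subs t y) \<le> m * ((r + (t - s) - 1) choose (t - s)) +
        (\<Sum>l\<in>{s<..t}. ((2 * l) choose l) * ((n + (t - l) - 1) choose (t - l)))"
      unfolding r_def using w assms n by (intro card_common_subs_le) (auto simp: words_def)
    then have "real (card (subs t x \<inter> subs t y)) \<le> real (m * ((r + (t - s) - 1) choose (t - s)) +
        (\<Sum>l\<in>{s<..t}. ((2 * l) choose l) * ((n + (t - l) - 1) choose (t - l))))"
      by (rule of_nat_mono)
    then have card: "real (card (subs t x \<inter> subs t y)) \<le> real m * real ((r + (t - s) - 1) choose (t - s)) +
        (\<Sum>l\<in>{s<..t}. real ((2 * l) choose l) * real ((n + (t - l) - 1) choose (t - l)))"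
      by simp
    have "real (card (subs t x \<inter> subs t y))
      \<le> real m * \<gamma> ^ (t - s) / fact (t - s) * real n ^ (t - s) + D * real n powi (int t - int s - 1)"
    proof (cases "t - s")
      \<comment> \<open>Here the sum over \<open>l\<close> is empty and the binomial is 1, so the
        count is at most \<open>m\<close>; the error term, with exponent -1, only has to be
        nonnegative.\<close>
      case 0
      then have "t = s" using assms by simp
      then show ?thesis using card D0 by (simp add: add_increasing2)
    next
      case (Suc k)
      have pow: "int t - int s - 1 = int k" using Suc by linarith
      let ?E = "(1 + real t) ^ t * real n ^ k"
      have le_fact: "a / fact p \<le> a" if "0 \<le> a" for a :: real and p
        using that by (simp add: divide_le_eq mult_le_cancel_left1 fact_ge_1)
      have "\<gamma> * real n \<le> real n" using \<gamma> by (simp add: mult_left_le_one_le)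
      then have "(\<gamma> * real n + real (t - s)) ^ Suc k
          \<le> (\<gamma> * real n) ^ Suc k + (1 + real (t - s)) ^ Suc k * real n ^ k"
        using \<gamma> n by (intro power_add_const_le) auto
      also have "(1 + real (t - s)) ^ Suc k \<le> (1 + real t) ^ t"
      proof (rule order_trans)
        show "(1 + real (t - s)) ^ Suc k \<le> (1 + real t) ^ Suc k" by (intro power_mono) auto
        show "(1 + real t) ^ Suc k \<le> (1 + real t) ^ t" using Suc by (intro power_increasing) auto
      qed
      finally have main: "(\<gamma> * real n + real (t - s)) ^ Suc k \<le> (\<gamma> * real n) ^ Suc k + ?E"
        by (simp add: mult_right_mono)
      have "real ((r + (t - s) - 1) choose (t - s)) \<le> (real r + real (t - s)) ^ (t - s) / fact (t - s)"
        by (rule choose_shift_le_power)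
      also have "\<dots> \<le> (\<gamma> * real n + real (t - s)) ^ (t - s) / fact (t - s)"
        using r by (intro divide_right_mono power_mono) auto
      also have "\<dots> \<le> ((\<gamma> * real n) ^ (t - s) + ?E) / fact (t - s)"
        using main Suc by (intro divide_right_mono) auto
      also have "\<dots> \<le> (\<gamma> * real n) ^ (t - s) / fact (t - s) + ?E"
        using le_fact[of ?E "t - s"] by (simp add: add_divide_distrib)
      finally have first: "real m * real ((r + (t - s) - 1) choose (t - s))
          \<le> real m * ((\<gamma> * real n) ^ (t - s) / fact (t - s) + ?E)"
        by (rule mult_left_mono) simp
      have second: "(\<Sum>l\<in>{s<..t}. real ((2 * l) choose l) * real ((n + (t - l) - 1) choose (t - l)))
          \<le> (\<Sum>l\<in>{s<..t}. real ((2 * l) choose l) * ?E)"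
      proof (intro sum_mono mult_left_mono)
        fix l assume l: "l \<in> {s<..t}"
        have "real ((n + (t - l) - 1) choose (t - l)) \<le> (real n + real (t - l)) ^ (t - l) / fact (t - l)"
          by (rule choose_shift_le_power)
        also have "\<dots> \<le> (real n + real (t - l)) ^ (t - l)" by (rule le_fact) simp
        also have "\<dots> \<le> ((1 + real t) * real n) ^ (t - l)"
        proof (rule power_mono)
          have "real (t - l) \<le> real t * 1" by simp
          also have "\<dots> \<le> real t * real n" using n by (intro mult_left_mono) auto
          finally show "real n + real (t - l) \<le> (1 + real t) * real n" by (simp add: algebra_simps)
        qed simp
        also have "\<dots> = (1 + real t) ^ (t - l) * real n ^ (t - l)" by (rule power_mult_distrib)
        \<comment> \<open>Since \<open>l > s\<close>, the exponent \<open>t - l\<close> is at most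
          \<open>k = t - s - 1\<close>, and both bases are at least 1.\<close>
        also have "\<dots> \<le> ?E"
          using l Suc n by (intro mult_mono power_increasing) auto
        finally show "real ((n + (t - l) - 1) choose (t - l)) \<le> ?E" .
      qed simp
      have "real m * ((\<gamma> * real n) ^ (t - s) / fact (t - s) + ?E) + (\<Sum>l\<in>{s<..t}. real ((2 * l) choose l) * ?E)
        = real m * \<gamma> ^ (t - s) / fact (t - s) * real n ^ (t - s) + D * real n ^ k"
        unfolding D_def by (simp add: algebra_simps power_mult_distrib sum_distrib_left)
      then show ?thesis using card first second unfolding pow power_int_of_nat by linarith
    qed
    then show ?thesis using w n by (simp add: deletion_ball_eq_subs[of _ q n])
  qed
  show ?thesis
  proof (intro exI[of _ D] allI impI)
    fix \<gamma> :: real and q :: nat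
    assume \<gamma>: "0 < \<gamma>" "\<gamma> \<le> 1" and q: "2 \<le> q"
    show "\<forall>\<^sub>F n in sequentially. real (max_ball_intersection q \<gamma> s t m n)
         \<le> real m * \<gamma> ^ (t - s) / fact (t - s) * real n ^ (t - s)
            + D * real n powi (int t - int s - 1)"
      \<comment> \<open>Nonemptiness makes the maximum attained; \<open>Suc t\<close> ensures both
        \<open>t \<le> n\<close> and \<open>1 \<le> n\<close>.\<close>
      using eventually_admissible_pairs_nonempty[OF \<gamma>(1) q, of s m] eventually_ge_at_top[of "Suc t"]
    proof eventually_elim
      case (elim n)
      have "max_ball_intersection q \<gamma> s t m n \<in>
          (\<lambda>(x, y). card (deletion_ball q t x \<inter> deletion_ball q t y)) ` admissible_pairs q \<gamma> s m n"
        unfolding max_ball_intersection_def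
        using elim(1) finite_admissible_pairs by (intro Max_in) auto
      then obtain x y where xy: "(x, y) \<in> admissible_pairs q \<gamma> s m n"
        "max_ball_intersection q \<gamma> s t m n = card (deletion_ball q t x \<inter> deletion_ball q t y)"
        by auto
      show ?case unfolding xy(2) using bound[OF \<gamma> _ _ xy(1)] elim(2) by simp
    qed
  qed
qed

end
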